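(* Let $(X,d)$ be a complete metric space, let $n\ge 1$ be an integer, let $\mathbb{S}_j\in\mathcal{S}_X^n$ for $j=1,2,\dots$, and let $\mathbb{S}\in\mathcal{S}_X^n$. Assume that $(\mathbb{S}_j)_{j\ge1}\to\mathbb{S}$ in $(\mathcal{S}_X^n,\mathcal{D})$. Let $A_j$ be the attractor of $\mathbb{S}_j$ for $j=1,2,\dots$ and let $A$ be the attractor of $\mathbb{S}$. Then $A_j\to A$ in the Hausdorff metric, i.e. $h(A_j,A)\to 0$ as $j\to\infty$.
   Context: A contraction on $X$ is a map $f:X\to X$ for which there is a constant $c\in[0,1)$ with $d(f(x),f(y))\le c\,d(x,y)$ for all $x,y\in X$. An $n$-iterated function system on $X$, written $\{X;f_1,\dots,f_n\}$, consists of $n$ contractions $f_1,\dots,f_n$ on $X$ (the order of listing being immaterial); $\mathcal{S}_X^n$ denotes the collection of all of them. For functions $f,g:X\to X$ put $$\bar{d}_\infty(f,g)=\sup_{x\in X}\frac{d(f(x),g(x))}{1+d(f(x),g(x))},$$ and for $\mathbb{S}=\{X;f_1,\dots,f_n\}$, $\mathbb{T}=\{X;g_1,\dots,g_n\}$ in $\mathcal{S}_X^n$ put $$\mathcal{D}(\mathbb{S},\mathbb{T})=\min_{\sigma\in S_n}\sum_{i=1}^{n}\bar{d}_\infty(f_i,g_{\sigma(i)}),$$ where $S_n$ is the group of permutations of $\{1,\dots,n\}$. The sequence $(\mathbb{S}_j)_{j\ge1}$ converges to $\mathbb{S}$ in $(\mathcal{S}_X^n,\mathcal{D})$ if for every $\epsilon>0$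 there is $N\in\mathbb{N}$ with $\mathcal{D}(\mathbb{S}_j,\mathbb{S})<\epsilon$ for all $j\ge N$. Let $\mathbb{H}(X)$ be the set of non-empty closed and bounded subsets of $X$. The Hausdorff metric on $\mathbb{H}(X)$ is $h(A,B)=\max\{\sup_{a\in A}\inf_{b\in B}d(a,b),\ \sup_{b\in B}\inf_{a\in A}d(a,b)\}$. The attractor of an iterated function system $\{X;f_1,\dots,f_n\}$ is the unique set $A\in\mathbb{H}(X)$ with $A=\bigcup_{i=1}^n f_i(A)$. *)

theory Defs
  imports "HOL-Analysis.Analysis" "HOL-Combinatorics.Permutations"
begin

definition is_contraction :: "('a::metric_space \<Rightarrow> 'a) \<Rightarrow> bool" where
  "is_contraction f \<longleftrightarrow> (\<exists>c. 0 \<le> c \<and> c < 1 \<and> (\<forall>x y. dist (f x) (f y) \<le> c * dist x y))"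

(* The listing order of the maps is immaterial but repetitions count, hence multisets. *)
definition ifs :: "nat \<Rightarrow> ('a::metric_space \<Rightarrow> 'a) multiset set" where
  "ifs n = {S. size S = n \<and> (\<forall>f \<in># S. is_contraction f)}"

definition dbar :: "('a::metric_space \<Rightarrow> 'a) \<Rightarrow> ('a \<Rightarrow> 'a) \<Rightarrow> real" where
  "dbar f g = (SUP x. dist (f x) (g x) / (1 + dist (f x) (g x)))"

definition list_dist :: "('a::metric_space \<Rightarrow> 'a) list \<Rightarrow> ('a \<Rightarrow> 'a) list \<Rightarrow> real" where
  "list_dist fs gs =
     Min ((\<lambda>\<sigma>. \<Sum>i<length fs. dbar (fs ! i) (gs ! \<sigma> i)) ` {\<sigma>. \<sigma> permutes {..<length fs}})"

(* The common value of list_dist over all listings; only meaningful if size S = size T.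
   See ifs_dist_mset below for the independence of the listings. *)
definition ifs_dist ::
    "('a::metric_space \<Rightarrow> 'a) multiset \<Rightarrow> ('a \<Rightarrow> 'a) multiset \<Rightarrow> real" where
  "ifs_dist S T = (THE r. \<exists>fs gs. mset fs = S \<and> mset gs = T \<and> r = list_dist fs gs)"

lemma list_dist_values_subset:
  fixes fs gs fs' gs' :: "('a::metric_space \<Rightarrow> 'a) list"
  assumes f: "mset fs = mset fs'" and g: "mset gs = mset gs'" and len: "length fs = length gs"
  shows "(\<lambda>\<sigma>. \<Sum>i<length fs'. dbar (fs' ! i) (gs' ! \<sigma> i)) ` {\<sigma>. \<sigma> permutes {..<length fs'}}
       \<subseteq> (\<lambda>\<sigma>. \<Sum>i<length fs. dbar (fs ! i) (gs ! \<sigma> i)) ` {\<sigma>. \<sigma> permutes {..<length fs}}"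
proof
  fix r
  assume "r \<in> (\<lambda>\<sigma>. \<Sum>i<length fs'. dbar (fs' ! i) (gs' ! \<sigma> i)) ` {\<sigma>. \<sigma> permutes {..<length fs'}}"
  moreover have lf: "length fs' = length fs" and lg: "length gs' = length gs"
    using mset_eq_length[OF f] mset_eq_length[OF g] by simp_all
  ultimately obtain s where s: "s permutes {..<length fs}"
    and r: "r = (\<Sum>i<length fs. dbar (fs' ! i) (gs' ! s i))" by auto
  obtain p where p: "p permutes {..<length fs}" "permute_list p fs = fs'"
    using mset_eq_permutation[OF f[symmetric]] by blast
  obtain q where q: "q permutes {..<length fs}" "permute_list q gs = gs'"
    using mset_eq_permutation[OF g[symmetric]] unfolding len by blast
  define t where "t = q \<circ> (s \<circ> inv p)"
  have t: "t permutes {..<length fs}"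
    unfolding t_def by (intro permutes_compose permutes_inv p q s)
  have "r = (\<Sum>i<length fs. dbar (fs ! p i) (gs ! t (p i)))"
    unfolding r
  proof (rule sum.cong[OF refl])
    fix i assume i: "i \<in> {..<length fs}"
    have "s i < length gs" using permutes_in_image[OF s] i len by auto
    then have "gs' ! s i = gs ! q (s i)"
      using q len permute_list_nth[of q gs "s i"] by simp
    moreover have "fs' ! i = fs ! p i" using p i permute_list_nth[of p fs i] by simp
    moreover have "t (p i) = q (s i)"
      using permutes_inverses(2)[OF p(1)] by (simp add: t_def)
    ultimately show "dbar (fs' ! i) (gs' ! s i) = dbar (fs ! p i) (gs ! t (p i))" by simp
  qed
  also have "\<dots> = (\<Sum>i<length fs. dbar (fs ! i) (gs ! t i))"
    by (rule sum.reindex_bij_betw[OF permutes_imp_bij[OF p(1)]])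
  finally show "r \<in> (\<lambda>\<sigma>. \<Sum>i<length fs. dbar (fs ! i) (gs ! \<sigma> i)) ` {\<sigma>. \<sigma> permutes {..<length fs}}"
    using t by auto
qed

lemma list_dist_cong_mset:
  assumes "mset fs = mset fs'" "mset gs = mset gs'" "length fs = length gs"
  shows "list_dist fs gs = list_dist fs' gs'"
proof -
  have len: "length fs' = length gs'"
    using mset_eq_length[OF assms(1)] mset_eq_length[OF assms(2)] assms(3) by simp
  show ?thesis
    unfolding list_dist_def
    by (rule arg_cong[where f = Min], rule subset_antisym)
      (intro list_dist_values_subset assms assms[symmetric] len)+
qed

lemma ifs_dist_mset:
  assumes "length fs = length gs"
  shows "ifs_dist (mset fs) (mset gs) = list_dist fs gs"
  unfolding ifs_dist_def
proof (rule the_equality)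
  show "\<exists>fs' gs'. mset fs' = mset fs \<and> mset gs' = mset gs \<and> list_dist fs gs = list_dist fs' gs'"
    by blast
next
  fix r
  assume "\<exists>fs' gs'. mset fs' = mset fs \<and> mset gs' = mset gs \<and> r = list_dist fs' gs'"
  then obtain fs' gs' where "mset fs' = mset fs" "mset gs' = mset gs" and r: "r = list_dist fs' gs'"
    by blast
  then have "list_dist fs gs = list_dist fs' gs'"
    by (intro list_dist_cong_mset assms) simp_all
  then show "r = list_dist fs gs" using r by simp
qed

definition ifs_converges ::
    "(nat \<Rightarrow> ('a::metric_space \<Rightarrow> 'a) multiset) \<Rightarrow> ('a \<Rightarrow> 'a) multiset \<Rightarrow> bool" where
  "ifs_converges S T \<longleftrightarrow> (\<forall>\<epsilon>>0. \<exists>N. \<forall>j\<ge>N. ifs_dist (S j) T < \<epsilon>)"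

definition closed_bounded_sets :: "'a::metric_space set set" where
  "closed_bounded_sets = {A. A \<noteq> {} \<and> closed A \<and> bounded A}"

definition hausdorff_dist :: "'a::metric_space set \<Rightarrow> 'a set \<Rightarrow> real" where
  "hausdorff_dist A B =
     max (SUP a\<in>A. INF b\<in>B. dist a b) (SUP b\<in>B. INF a\<in>A. dist a b)"

definition attractor :: "('a::metric_space \<Rightarrow> 'a) multiset \<Rightarrow> 'a set" where
  "attractor S = (THE A. A \<in> closed_bounded_sets \<and> A = (\<Union>f\<in>set_mset S. f ` A))"

end

theory Submission
  imports Defs
begin

text \<open>
  Everything rests on one estimate (\<open>infdist_le_of_shadowing\<close>). Suppose that \<open>A\<close> is bounded and covered by its
  images under a family \<open>F\<close>, that \<open>B\<close> is mapped into itself by a family \<open>G\<close>, and that each \<open>f \<in> F\<close>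
  has a partner \<open>g \<in> G\<close> with \<open>dist (f x) (g y) \<le> \<eta> + c * dist x y\<close> for all \<open>x\<close> and \<open>y\<close>. Writing
  \<open>a \<in> A\<close> as \<open>f x\<close> with \<open>x \<in> A\<close> and moving \<open>y \<in> B\<close> close to \<open>x\<close> shows that the supremum \<open>D\<close> of the
  distances from points of \<open>A\<close> to \<open>B\<close> satisfies \<open>D \<le> \<eta> + c * D\<close>, that is, \<open>D \<le> \<eta> / (1 - c)\<close>.

  If \<open>\<D>(\<S>\<^sub>j, \<T>)\<close> is small, an optimal permutation pairs the maps of \<open>\<S>\<^sub>j\<close> with those of \<open>\<T>\<close> so that
  partners are uniformly within \<open>\<eta>\<close> of each other (\<open>ifs_dist_less_imp_partners\<close>). The partner
  condition then holds in both directions with a contraction constant \<open>c\<close> of the \<^emph>\<open>limit\<close> system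
  alone, so it does not matter that the constants of the \<open>\<S>\<^sub>j\<close> may approach 1. This gives
  \<open>h(A\<^sub>j, A) \<le> \<eta> / (1 - c)\<close>.

  The estimate with \<open>\<eta> = 0\<close> also shows that the attractor is unique. For its existence
  (\<open>attractor_exists\<close>), some ball is mapped into itself, and the largest subset \<open>K\<close> of
  that ball contained in the union of its own images satisfies \<open>K = (\<Union>f\<in>F. f ` K)\<close>. Iterating this
  equation covers \<open>K\<close> by finitely many arbitrarily small balls, so \<open>closure K\<close> is compact; its images
  are then closed, and \<open>closure K\<close> is the attractor.
\<close>

section \<open>Distances between invariant sets\<close>

lemma infdist_le_of_shadowing:
  fixes A B :: "'a::metric_space set"
  assumes A: "A \<noteq> {}" "bounded A" "A \<subseteq> (\<Union>f\<in>F. f ` A)"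
    and B: "B \<noteq> {}" "\<And>g. g \<in> G \<Longrightarrow> g ` B \<subseteq> B"
    and c: "0 \<le> c" "c < 1"
    and near: "\<And>f. f \<in> F \<Longrightarrow> \<exists>g\<in>G. \<forall>x y. dist (f x) (g y) \<le> \<eta> + c * dist x y"
    and a: "a \<in> A"
  shows "infdist a B \<le> \<eta> / (1 - c)"
proof -
  define D where "D = (SUP x\<in>A. infdist x B)"
  obtain b where b: "b \<in> B" using B(1) by blast
  obtain r where r: "\<And>x. x \<in> A \<Longrightarrow> dist b x \<le> r"
    using A(2) by (auto simp: bounded_any_center[where a = b])
  have "bdd_above ((\<lambda>x. infdist x B) ` A)"
  proof (rule bdd_aboveI2)
    fix x assume "x \<in> A"
    then show "infdist x B \<le> r" using infdist_le[OF b, of x] r[of x] by (simp add: dist_commute)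
  qed
  then have le_D: "infdist x B \<le> D" if "x \<in> A" for x
    unfolding D_def using that by (rule cSUP_upper[rotated])
  have "infdist x B \<le> \<eta> + c * D" if "x \<in> A" for x
  proof -
    obtain f z where f: "f \<in> F" "z \<in> A" "x = f z" using A(3) \<open>x \<in> A\<close> by blast
    obtain g where g: "g \<in> G" "\<And>y. dist (f z) (g y) \<le> \<eta> + c * dist z y"
      using near[OF f(1)] by blast
    have ge: "infdist x B - \<eta> \<le> c * dist z y" if "y \<in> B" for y
    proof -
      have "g y \<in> B" using B(2)[OF g(1)] that by blast
      from infdist_le[OF this, of x] g(2)[of y] show ?thesis by (simp add: f(3))
    qed
    have "infdist x B - \<eta> \<le> c * infdist z B"
    proof (cases "c = 0")
      case True
      then show ?thesis using ge[OF b] by simp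
    next
      case False
      then have "0 < c" using c by simp
      have "(infdist x B - \<eta>) / c \<le> infdist z B"
        unfolding infdist_notempty[OF B(1), of z]
        by (rule cINF_greatest[OF B(1)]) (use ge \<open>0 < c\<close> in \<open>simp add: pos_divide_le_eq mult.commute\<close>)
      then show ?thesis using \<open>0 < c\<close> by (simp add: field_simps)
    qed
    also have "\<dots> \<le> c * D" using le_D[OF f(2)] c by (intro mult_left_mono)
    finally show ?thesis by simp
  qed
  then have "D \<le> \<eta> + c * D"
    unfolding D_def by (intro cSUP_least A(1))
  then have "D \<le> \<eta> / (1 - c)" using c by (simp add: field_simps)
  with le_D[OF a] show ?thesis by simp
qed

lemma hausdorff_dist_bounds:
  assumes "A \<noteq> {}" "B \<noteq> {}"
    and AB: "\<And>a. a \<in> A \<Longrightarrow> infdist a B \<le> r" and BA: "\<And>b. b \<in> B \<Longrightarrow> infdist b A \<le> r"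
  shows "0 \<le> hausdorff_dist A B" "hausdorff_dist A B \<le> r"
proof -
  have h: "hausdorff_dist A B = max (SUP a\<in>A. infdist a B) (SUP b\<in>B. infdist b A)"
    unfolding hausdorff_dist_def by (simp add: infdist_notempty assms dist_commute)
  show "hausdorff_dist A B \<le> r"
    unfolding h by (intro max.boundedI cSUP_least assms)
  obtain a where a: "a \<in> A" using \<open>A \<noteq> {}\<close> by blast
  have "0 \<le> infdist a B" by (rule infdist_nonneg)
  also have "\<dots> \<le> (SUP a\<in>A. infdist a B)"
    using a by (rule cSUP_upper) (rule bdd_aboveI2, rule AB)
  finally show "0 \<le> hausdorff_dist A B" unfolding h by simp
qed

section \<open>Existence and uniqueness of the attractor\<close>

lemma uniform_contraction_constant:
  fixes F :: "('a::metric_space \<Rightarrow> 'a) set"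
  assumes "finite F" "\<And>f. f \<in> F \<Longrightarrow> is_contraction f"
  obtains c where "0 \<le> c" "c < 1" "\<And>f x y. f \<in> F \<Longrightarrow> dist (f x) (f y) \<le> c * dist x y"
proof -
  have "\<exists>c. 0 \<le> c \<and> c < 1 \<and> (\<forall>f\<in>F. \<forall>x y. dist (f x) (f y) \<le> c * dist x y)"
    using assms
  proof (induction F rule: finite_induct)
    case empty
    show ?case by (rule exI[of _ 0]) simp
  next
    case (insert f F)
    then obtain c where c: "0 \<le> c" "c < 1" "\<And>g x y. g \<in> F \<Longrightarrow> dist (g x) (g y) \<le> c * dist x y"
      by (metis insertCI)
    obtain c' where c': "0 \<le> c'" "c' < 1" "\<And>x y. dist (f x) (f y) \<le> c' * dist x y"
      using insert.prems[of f] by (auto simp: is_contraction_def)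
    have m: "c * dist x y \<le> max c c' * dist x y" 
      "c' * dist x y \<le> max c c' * dist x y" for x y :: 'a
      by (intro mult_right_mono; simp)+
    have "dist (g x) (g y) \<le> max c c' * dist x y" if "g \<in> insert f F" for g x y
      using that c(3) c'(3) m order_trans by blast
    then show ?case using c c' by (intro exI[of _ "max c c'"]) auto
  qed
  then show thesis using that by blast
qed

text \<open>
  Iterating \<open>K \<subseteq> (\<Union>f\<in>F. f ` K)\<close> \<open>m\<close> times turns one ball of radius \<open>R\<close> containing \<open>K\<close> into finitely many
  balls of radius \<open>c ^ m * R\<close> covering it, so \<open>K\<close> is totally bounded.
\<close>

lemma compact_closure_self_similar:
  fixes K :: "'a::complete_space set"
  assumes F: "finite F" and K: "bounded K" "K \<subseteq> (\<Union>f\<in>F. f ` K)"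
    and c: "0 \<le> c" "c < 1" "\<And>f x y. f \<in> F \<Longrightarrow> dist (f x) (f y) \<le> c * dist x y"
  shows "compact (closure K)"
  unfolding compact_eq_totally_bounded
proof (intro conjI allI impI)
  show "complete (closure K)" by (simp add: complete_eq_closed)
  obtain x0 R where R: "K \<subseteq> cball x0 R" using K(1) by (auto simp: bounded_subset_cball)
  have cover: "\<exists>k. finite k \<and> K \<subseteq> (\<Union>x\<in>k. cball x (c ^ m * R))" for m
  proof (induction m)
    case 0
    show ?case by (rule exI[of _ "{x0}"]) (use R in simp)
  next
    case (Suc m)
    then obtain k where k: "finite k" "K \<subseteq> (\<Union>x\<in>k. cball x (c ^ m * R))" by blast
    have "K \<subseteq> (\<Union>x\<in>(\<Union>f\<in>F. f ` k). cball x (c ^ Suc m * R))"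
    proof
      fix y assume "y \<in> K"
      then obtain f z where f: "f \<in> F" "z \<in> K" "y = f z" using K(2) by blast
      then obtain x where x: "x \<in> k" "dist x z \<le> c ^ m * R" using k(2) by fastforce
      have "dist (f x) y \<le> c * dist x z" using c(3)[OF f(1)] f(3) by simp
      also have "\<dots> \<le> c * (c ^ m * R)" using x(2) c(1) by (rule mult_left_mono)
      finally show "y \<in> (\<Union>x\<in>(\<Union>f\<in>F. f ` k). cball x (c ^ Suc m * R))"
        using f(1) x(1) by (auto simp: mult.assoc)
    qed
    then show ?case using F k(1) by (intro exI[of _ "\<Union>f\<in>F. f ` k"]) simp
  qed
  fix e :: real assume "0 < e"
  have "(\<lambda>m. c ^ m * R) \<longlonglongrightarrow> 0 * R"
    using c by (intro tendsto_mult_right LIMSEQ_power_zero) simp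
  then have "\<forall>\<^sub>F m in sequentially. c ^ m * R < e"
    using \<open>0 < e\<close> by (simp add: order_tendstoD(2))
  then obtain m where m: "c ^ m * R < e" by (auto simp: eventually_sequentially)
  obtain k where k: "finite k" "K \<subseteq> (\<Union>x\<in>k. cball x (c ^ m * R))" using cover by blast
  have "closure K \<subseteq> (\<Union>x\<in>k. cball x (c ^ m * R))"
    using k by (intro closure_minimal closed_UN) auto
  also have "\<dots> \<subseteq> (\<Union>x\<in>k. ball x e)" using m by fastforce
  finally show "\<exists>k. finite k \<and> closure K \<subseteq> (\<Union>x\<in>k. ball x e)" using k(1) by blast
qed

lemma attractor_exists:
  fixes F :: "('a::complete_space \<Rightarrow> 'a) set"
  assumes F: "finite F" "F \<noteq> {}"
    and c: "0 \<le> c" "c < 1" "\<And>f x y. f \<in> F \<Longrightarrow> dist (f x) (f y) \<le> c * dist x y"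
  shows "\<exists>A\<in>closed_bounded_sets. A = (\<Union>f\<in>F. f ` A)"
proof -
  obtain f0 where f0: "f0 \<in> F" using F(2) by blast
  obtain p where p: "f0 p = p"
    using banach_fix_type[OF c(1,2), of f0] c(3)[OF f0] by blast
  define M where "M = Max ((\<lambda>f. dist p (f p)) ` F)"
  have M: "dist p (f p) \<le> M" if "f \<in> F" for f unfolding M_def using F(1) that by simp
  have "0 \<le> M" using M[OF f0] p by simp
  \<comment> \<open>The radius \<open>R\<close> solves \<open>M + c * R = R\<close>, so every map sends \<open>cball p R\<close> into itself.\<close>
  define R where "R = M / (1 - c)"
  have "M + c * R = R" unfolding R_def using c by (simp add: field_simps)
  have "0 \<le> R" unfolding R_def using \<open>0 \<le> M\<close> c by simp
  have inv: "f ` cball p R \<subseteq> cball p R" if f: "f \<in> F" for f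
  proof
    fix y assume "y \<in> f ` cball p R"
    then obtain x where x: "dist p x \<le> R" "y = f x" by auto
    have "dist p y \<le> dist p (f p) + dist (f p) (f x)" using x dist_triangle by simp
    also have "\<dots> \<le> M + c * dist p x" using M[OF f] c(3)[OF f] by (intro add_mono)
    also have "\<dots> \<le> M + c * R" using x c by (simp add: mult_left_mono)
    finally show "y \<in> cball p R" using \<open>M + c * R = R\<close> by simp
  qed
  define H where "H X = (\<Union>f\<in>F. f ` X)" for X
  have H_mono: "H X \<subseteq> H Y" if "X \<subseteq> Y" for X Y unfolding H_def using that by blast
  \<comment> \<open>\<open>K\<close> is the greatest fixed point of \<open>H\<close> below \<open>cball p R\<close>, by the Knaster-Tarski argument. It need
    not be known to be closed; it is non-empty because \<open>{p} \<subseteq> H {p}\<close>.\<close>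
  define K where "K = \<Union>{X. X \<subseteq> cball p R \<and> X \<subseteq> H X}"
  have K_ball: "K \<subseteq> cball p R" unfolding K_def by blast
  have K_H: "K \<subseteq> H K"
  proof
    fix x assume "x \<in> K"
    then obtain X where X: "X \<subseteq> cball p R" "X \<subseteq> H X" "x \<in> X" unfolding K_def by blast
    then have "X \<subseteq> K" unfolding K_def by blast
    with X(2,3) H_mono show "x \<in> H K" by blast
  qed
  have "H K \<subseteq> cball p R" using K_ball inv unfolding H_def by blast
  then have H_K: "H K \<subseteq> K" using H_mono[OF K_H] unfolding K_def by blast
  have "p \<in> H {p}" unfolding H_def using f0 p by (metis UN_I image_eqI singletonI)
  then have "p \<in> K" unfolding K_def using \<open>0 \<le> R\<close> by (auto intro!: exI[of _ "{p}"])
  have "bounded K" using K_ball bounded_cball bounded_subset by blast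
  then have comp: "compact (closure K)"
    using F(1) K_H c unfolding H_def by (intro compact_closure_self_similar)
  have cont: "continuous_on X f" if "f \<in> F" for f X
    using c(1) c(3)[OF that]
    by (intro lipschitz_on_continuous_on[where L = c] lipschitz_onI) auto
  have "compact (H (closure K))"
    unfolding H_def using F(1) comp cont by (intro compact_UN compact_continuous_image)
  then have "closure K \<subseteq> H (closure K)"
    using K_H H_mono[OF closure_subset[of K]]
    by (intro closure_minimal) (auto intro: compact_imp_closed)
  moreover have "H (closure K) \<subseteq> closure K"
    unfolding H_def
  proof (rule UN_least)
    fix f assume "f \<in> F"
    then show "f ` closure K \<subseteq> closure K"
      using H_K closure_subset[of K] unfolding H_def
      by (intro image_closure_subset[OF cont]) auto
  qed
  ultimately have "closure K = H (closure K)" by (rule subset_antisym)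
  moreover have "closure K \<in> closed_bounded_sets"
    unfolding closed_bounded_sets_def using \<open>p \<in> K\<close> \<open>bounded K\<close> closure_subset by auto
  ultimately show ?thesis unfolding H_def by blast
qed

lemma attractor_unique:
  fixes A B :: "'a::metric_space set"
  assumes c: "0 \<le> c" "c < 1" "\<And>f x y. f \<in> F \<Longrightarrow> dist (f x) (f y) \<le> c * dist x y"
    and A: "A \<in> closed_bounded_sets" "A = (\<Union>f\<in>F. f ` A)"
    and B: "B \<in> closed_bounded_sets" "B = (\<Union>f\<in>F. f ` B)"
  shows "A = B"
proof -
  have sub: "X \<subseteq> Y"
    if X: "X \<in> closed_bounded_sets" "X = (\<Union>f\<in>F. f ` X)"
      and Y: "Y \<in> closed_bounded_sets" "Y = (\<Union>f\<in>F. f ` Y)" for X Y :: "'a set"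
  proof
    fix x assume "x \<in> X"
    have "infdist x Y \<le> 0 / (1 - c)"
      by (rule infdist_le_of_shadowing[of X F Y F])
        (use X Y c \<open>x \<in> X\<close> in \<open>(simp add: closed_bounded_sets_def; blast)+\<close>)
    then have "infdist x Y = 0" using infdist_nonneg[of x Y] by simp
    then show "x \<in> Y"
      using Y(1) by (auto simp: closed_bounded_sets_def in_closed_iff_infdist_zero)
  qed
  from sub[OF A B] sub[OF B A] show ?thesis by (rule subset_antisym)
qed

lemma attractor_properties:
  fixes S :: "('a::complete_space \<Rightarrow> 'a) multiset"
  assumes "S \<in> ifs n" "n \<ge> 1"
  shows "attractor S \<in> closed_bounded_sets"
    and "attractor S = (\<Union>f\<in>set_mset S. f ` attractor S)"
proof -
  have "set_mset S \<noteq> {}" using assms by (auto simp: ifs_def)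
  obtain c where c: "0 \<le> c" "c < 1"
      "\<And>f x y. f \<in> set_mset S \<Longrightarrow> dist (f x) (f y) \<le> c * dist x y"
    using assms(1) uniform_contraction_constant[of "set_mset S"] by (auto simp: ifs_def)
  obtain A where "A \<in> closed_bounded_sets" "A = (\<Union>f\<in>set_mset S. f ` A)"
    using attractor_exists[OF finite_set_mset \<open>set_mset S \<noteq> {}\<close> c] by blast
  then have "\<exists>!A. A \<in> closed_bounded_sets \<and> A = (\<Union>f\<in>set_mset S. f ` A)"
    using attractor_unique[OF c] by (intro ex1I[of _ A]) blast+
  from theI'[OF this]
  show "attractor S \<in> closed_bounded_sets"
    and "attractor S = (\<Union>f\<in>set_mset S. f ` attractor S)"
    unfolding attractor_def by blast+
qed

section \<open>Pairing the maps of nearby systems\<close>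

lemma dbar_upper: "dist (f x) (g x) / (1 + dist (f x) (g x)) \<le> dbar f g"
  unfolding dbar_def
proof (rule cSUP_upper)
  show "bdd_above (range (\<lambda>x. dist (f x) (g x) / (1 + dist (f x) (g x))))"
  proof (rule bdd_aboveI2)
    fix x show "dist (f x) (g x) / (1 + dist (f x) (g x)) \<le> 1"
      using zero_le_dist[of "f x" "g x"] by (simp add: divide_le_eq_1 add_pos_nonneg)
  qed
qed simp

lemma dbar_nonneg: "0 \<le> dbar f g"
proof -
  have "0 \<le> dist (f undefined) (g undefined) / (1 + dist (f undefined) (g undefined))" by simp
  also have "\<dots> \<le> dbar f g" by (rule dbar_upper)
  finally show ?thesis .
qed

text \<open>The threshold is \<open>\<eta> / (1 + \<eta>)\<close> because \<open>t / (1 + t)\<close> is strictly increasing in \<open>t \<ge> 0\<close>.\<close>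

lemma dist_le_of_dbar_less:
  assumes "dbar f g < \<eta> / (1 + \<eta>)" "0 < \<eta>"
  shows "dist (f x) (g x) \<le> \<eta>"
proof -
  define d where "d = dist (f x) (g x)"
  have "0 \<le> d" unfolding d_def by simp
  have "d / (1 + d) < \<eta> / (1 + \<eta>)" unfolding d_def using dbar_upper[of f x g] assms(1) by simp
  then have "d < \<eta>" using \<open>0 \<le> d\<close> assms(2) by (simp add: divide_simps algebra_simps)
  then show ?thesis by (simp add: d_def)
qed

lemma ifs_dist_less_imp_partners:
  assumes size: "size S = size T" and \<eta>: "0 < \<eta>" and less: "ifs_dist S T < \<eta> / (1 + \<eta>)"
  shows "f \<in># S \<Longrightarrow> \<exists>g\<in>#T. \<forall>x. dist (f x) (g x) \<le> \<eta>"
    and "g \<in># T \<Longrightarrow> \<exists>f\<in>#S. \<forall>x. dist (f x) (g x) \<le> \<eta>"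
proof -
  obtain fs gs where fg: "mset fs = S" "mset gs = T" by (metis ex_mset)
  then have len: "length fs = length gs" using size by (metis size_mset)
  let ?P = "{\<sigma>. \<sigma> permutes {..<length fs}}"
  let ?d = "\<lambda>\<sigma>. \<Sum>i<length fs. dbar (fs ! i) (gs ! \<sigma> i)"
  have "Min (?d ` ?P) \<in> ?d ` ?P"
    by (intro Min_in) (auto simp: finite_permutations intro: permutes_id)
  moreover have "Min (?d ` ?P) < \<eta> / (1 + \<eta>)"
    using less ifs_dist_mset[OF len] by (simp add: fg list_dist_def)
  ultimately obtain \<sigma> where \<sigma>: "\<sigma> permutes {..<length fs}" and sum: "?d \<sigma> < \<eta> / (1 + \<eta>)"
    by auto
  have near: "dist ((fs ! i) x) ((gs ! \<sigma> i) x) \<le> \<eta>" if "i < length fs" for i x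
  proof (rule dist_le_of_dbar_less[where f = "fs ! i" and g = "gs ! \<sigma> i", OF _ \<eta>])
    have "dbar (fs ! i) (gs ! \<sigma> i) \<le> ?d \<sigma>"
      by (rule member_le_sum[where f = "\<lambda>i. dbar (fs ! i) (gs ! \<sigma> i)"])
        (use that dbar_nonneg in auto)
    with sum show "dbar (fs ! i) (gs ! \<sigma> i) < \<eta> / (1 + \<eta>)" by simp
  qed
  show "\<exists>g\<in>#T. \<forall>x. dist (f x) (g x) \<le> \<eta>" if f: "f \<in># S"
  proof -
    obtain i where i: "i < length fs" "f = fs ! i"
      using f by (auto simp: fg(1)[symmetric] in_set_conv_nth)
    have "\<sigma> i < length gs" using permutes_in_image[OF \<sigma>, of i] i(1) len by simp
    then have "gs ! \<sigma> i \<in># T" by (auto simp: fg(2)[symmetric])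
    with near[OF i(1)] i(2) show ?thesis by blast
  qed
  show "\<exists>f\<in>#S. \<forall>x. dist (f x) (g x) \<le> \<eta>" if g: "g \<in># T"
  proof -
    obtain k where k: "k < length fs" "g = gs ! k"
      using g len by (auto simp: fg(2)[symmetric] in_set_conv_nth)
    then have "k \<in> \<sigma> ` {..<length fs}" using permutes_image[OF \<sigma>] by simp
    then obtain i where i: "i < length fs" "g = gs ! \<sigma> i" using k(2) by auto
    have "fs ! i \<in># S" using i(1) by (auto simp: fg(1)[symmetric])
    with near[OF i(1)] i(2) show ?thesis by blast
  qed
qed

section \<open>Continuity of the attractor\<close>

text \<open>
  The bound involves a contraction constant of \<open>T\<close> only. Shadowing is needed in both directions, but
  the triangle inequality can always be routed so that it is the map from \<open>T\<close> that is applied to two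
  different points.
\<close>

lemma hausdorff_dist_attractor_bounds:
  fixes S T :: "('a::complete_space \<Rightarrow> 'a) multiset"
  assumes n: "n \<ge> 1" and S: "S \<in> ifs n" and T: "T \<in> ifs n"
    and c: "0 \<le> c" "c < 1" "\<And>g x y. g \<in># T \<Longrightarrow> dist (g x) (g y) \<le> c * dist x y"
    and \<eta>: "0 < \<eta>" and less: "ifs_dist S T < \<eta> / (1 + \<eta>)"
  shows "0 \<le> hausdorff_dist (attractor S) (attractor T)"
    and "hausdorff_dist (attractor S) (attractor T) \<le> \<eta> / (1 - c)"
proof -
  note AS = attractor_properties[OF S n] and AT = attractor_properties[OF T n]
  have size: "size S = size T" using S T by (simp add: ifs_def)
  note partners = ifs_dist_less_imp_partners[OF size \<eta> less]
  have shadow: "dist (f x) (g y) \<le> \<eta> + c * dist x y"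
    if "g \<in># T" "\<forall>x. dist (f x) (g x) \<le> \<eta>" for f g x y
  proof -
    have "dist (f x) (g y) \<le> dist (f x) (g x) + dist (g x) (g y)" by (rule dist_triangle)
    also have "\<dots> \<le> \<eta> + c * dist x y" using that(2) c(3)[OF that(1)] by (intro add_mono) auto
    finally show ?thesis .
  qed
  have ST: "infdist a (attractor T) \<le> \<eta> / (1 - c)" if "a \<in> attractor S" for a
  proof (rule infdist_le_of_shadowing[where A = "attractor S" and F = "set_mset S"
        and G = "set_mset T"])
    show "\<exists>g\<in>#T. \<forall>x y. dist (f x) (g y) \<le> \<eta> + c * dist x y" if "f \<in># S" for f
      using partners(1)[OF that] shadow by blast
  qed (use AS AT c that in \<open>auto simp: closed_bounded_sets_def\<close>)
  have TS: "infdist a (attractor S) \<le> \<eta> / (1 - c)" if "a \<in> attractor T" for a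
  proof (rule infdist_le_of_shadowing[where A = "attractor T" and F = "set_mset T"
        and G = "set_mset S"])
    show "\<exists>f\<in>#S. \<forall>x y. dist (g x) (f y) \<le> \<eta> + c * dist x y" if g: "g \<in># T" for g
    proof -
      obtain f where f: "f \<in># S" "\<forall>x. dist (f x) (g x) \<le> \<eta>" using partners(2)[OF g] by blast
      have "dist (g x) (f y) \<le> \<eta> + c * dist x y" for x y
        using shadow[OF g f(2), of y x] by (simp add: dist_commute)
      with f(1) show ?thesis by blast
    qed
  qed (use AS AT c that in \<open>auto simp: closed_bounded_sets_def\<close>)
  have "attractor S \<noteq> {}" "attractor T \<noteq> {}"
    using AS(1) AT(1) by (auto simp: closed_bounded_sets_def)
  from hausdorff_dist_bounds[OF this ST TS]
  show "0 \<le> hausdorff_dist (attractor S) (attractor T)"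
    and "hausdorff_dist (attractor S) (attractor T) \<le> \<eta> / (1 - c)" by blast+
qed

theorem theorem3p11:
  fixes S :: "nat \<Rightarrow> ('a::complete_space \<Rightarrow> 'a) multiset"
    and T :: "('a \<Rightarrow> 'a) multiset"
    and n :: nat
  assumes "n \<ge> 1"
    and "\<And>j. j \<ge> 1 \<Longrightarrow> S j \<in> ifs n"
    and "T \<in> ifs n"
    and "ifs_converges S T"
  shows "(\<lambda>j. hausdorff_dist (attractor (S j)) (attractor T)) \<longlonglongrightarrow> 0"
proof (rule LIMSEQ_I)
  fix r :: real assume r: "0 < r"
  obtain c where c: "0 \<le> c" "c < 1" "\<And>g x y. g \<in># T \<Longrightarrow> dist (g x) (g y) \<le> c * dist x y"
    using assms(3) uniform_contraction_constant[of "set_mset T"] by (auto simp: ifs_def)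
  define \<eta> where "\<eta> = (1 - c) * r / 2"
  have \<eta>: "0 < \<eta>" "\<eta> / (1 - c) < r" unfolding \<eta>_def using r c by (simp_all add: field_simps)
  then obtain N where N: "\<And>j. j \<ge> N \<Longrightarrow> ifs_dist (S j) T < \<eta> / (1 + \<eta>)"
    using assms(4) unfolding ifs_converges_def by (metis add_pos_pos divide_pos_pos zero_less_one)
  \<comment> \<open>Nothing is assumed about \<open>S 0\<close>, hence the lower bound 1 on \<open>j\<close>.\<close>
  have "norm (hausdorff_dist (attractor (S j)) (attractor T) - 0) < r" if "j \<ge> max N 1" for j
  proof -
    have "S j \<in> ifs n" "ifs_dist (S j) T < \<eta> / (1 + \<eta>)" using that assms(2) N by simp_all
    from hausdorff_dist_attractor_bounds[OF assms(1) this(1) assms(3) c \<eta>(1) this(2)] \<eta>(2)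
    show ?thesis by simp
  qed
  then show "\<exists>N. \<forall>j\<ge>N. norm (hausdorff_dist (attractor (S j)) (attractor T) - 0) < r" by blast
qed

end
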